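(* Let $\epsilon>0$ be a constant, let $d$ be a sufficiently large positive integer, let $k=\Theta(d)$ be an even integer with $k\le d$, and put $t=k/2$. Let $n=\Omega(d^{\epsilon})$. Let $b\subseteq[d]$ be any subset with $|b|=k$, with elements enumerated as $j_1,\dots,j_k$, and let $v_b\in\{0,1\}^d$ be its indicator vector. Let $x^1,\dots,x^n$ be i.i.d. uniform on $\{0,1\}^d$, let $x_j\in\mathbb{R}^n$ ($j\in[d]$) be the vector with $(x_j)_l=(x^l)_j$, and let $X=(x_1\ \cdots\ x_d)\in\mathbb{R}^{n\times d}$. For $i\in[t]$ let $x_{d+i}\in\mathbb{R}^n$ be given by $(x_{d+i})_l=(x_{j_{2i-1}})_l\,(x_{j_{2i}})_l$ for $l\in[n]$, and let $E=(x_{d+1}\ \cdots\ x_{d+t})\in\mathbb{R}^{n\times t}$. Define, for $W\in\mathbb{R}^{d\times t}$, $$L(W)=\frac{1}{2n}\,\|\mathrm{Att}_W(X)-E\|_F^2,\qquad \mathrm{Att}_W(X)=X\,\mathrm{softmax}(W).$$ Let $\widetilde\nabla$ be any $O(d^{-1-\epsilon/4})$-approximate gradient oracle for $L$, let $W^{(0)}=\mathbf{0}_{d\times t}$, let $\eta=\Theta(d^{1+\epsilon/8})$, and let $W^{(1)}=W^{(0)}-\eta\,\widetilde\nabla L(W^{(0)})$. Then, with probability at least $1-\exp(-\Theta(d^{\epsilon/2}))$ over the random samples, $$\big\|\,2\,\mathrm{softmax}(W^{(1)})\,\mathbf{1}_t-v_b\,\big\|_\infty\le O(d^{-\epsilo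n/8}).$$
   Context: $[m]=\{1,\dots,m\}$; $\mathbf{1}_t$ is the all-ones vector of length $t$; $\|\cdot\|_F$ is the Frobenius norm; $\|u\|_\infty=\max_i|u_i|$. The column-wise softmax $\mathrm{softmax}:\mathbb{R}^{d\times t}\to\mathbb{R}^{d\times t}$ is $\mathrm{softmax}(W)_{j,m}=e^{W_{j,m}}/\sum_{i=1}^d e^{W_{i,m}}$. The indicator vector $v_b$ has $j$-th entry $1$ if $j\in b$ and $0$ otherwise. A $\delta$-approximate gradient oracle for $L$ returns, at each $W$, a matrix $\widetilde\nabla L(W)$ each of whose entries differs from the corresponding entry of $\nabla L(W)$ by at most $\delta$ in absolute value. Asymptotic notation is as $d\to\infty$: the implied constants in the conclusion (including the constant $c>0$ in $\exp(-c\,d^{\epsilon/2})$) and the threshold for $d$ depend only on $\epsilon$ and on the implied constants in the hypotheses, and not on $b$ or its enumeration. (Background: the learning problem is to recover the unknown size-$k$ set $b$ of relevant bits of a $k$-bit AND/OR function of $d$-bit inputs; the columns of $E$ are the intermediate supervision ("teacher forcing") signals.) *)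

theory Defs
  imports "HOL-Probability.Product_PMF" "Jordan_Normal_Form.Matrix"
begin

unbundle no vec_syntax

text \<open>
  All indices start at 0: the set \<open>{1, \<dots>, m}\<close> is rendered as \<open>{..<m}\<close>.
\<close>

definition softmax :: "real mat \<Rightarrow> real mat" where
  "softmax W = mat (dim_row W) (dim_col W)
     (\<lambda>(j, m). exp (W $$ (j, m)) / (\<Sum>i<dim_row W. exp (W $$ (i, m))))"

definition frobenius_norm :: "real mat \<Rightarrow> real" where
  "frobenius_norm A = sqrt (\<Sum>i<dim_row A. \<Sum>j<dim_col A. (A $$ (i, j))\<^sup>2)"

definition linf_norm :: "real vec \<Rightarrow> real" where
  "linf_norm u = Max ((\<lambda>i. \<bar>u $ i\<bar>) ` {..<dim_vec u})"

definition all_ones :: "nat \<Rightarrow> real vec" where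
  "all_ones t = vec t (\<lambda>_. 1)"

definition indicator_vec :: "nat \<Rightarrow> nat set \<Rightarrow> real vec" where
  "indicator_vec d b = vec d (\<lambda>j. if j \<in> b then 1 else 0)"

definition unit_mat :: "nat \<Rightarrow> nat \<Rightarrow> nat \<Rightarrow> nat \<Rightarrow> real mat" where
  "unit_mat r c i j = mat r c (\<lambda>p. if p = (i, j) then 1 else 0)"

text \<open>
  The matrix of partial derivatives. Since \<open>deriv\<close> is total, this is only meaningful where the
  partial derivatives exist; see \<open>loss_partial_differentiable\<close> below.
\<close>

definition gradient :: "(real mat \<Rightarrow> real) \<Rightarrow> real mat \<Rightarrow> real mat" where
  "gradient f W = mat (dim_row W) (dim_col W)
     (\<lambda>(i, j). deriv (\<lambda>s. f (W + s \<cdot>\<^sub>m unit_mat (dim_row W) (dim_col W) i j)) 0)"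

definition approx_gradient_oracle ::
    "real \<Rightarrow> nat \<Rightarrow> nat \<Rightarrow> (real mat \<Rightarrow> real) \<Rightarrow> (real mat \<Rightarrow> real mat) \<Rightarrow> bool" where
  "approx_gradient_oracle \<delta> r c f G \<longleftrightarrow>
     (\<forall>W \<in> carrier_mat r c. G W \<in> carrier_mat r c \<and>
        (\<forall>i<r. \<forall>j<c. \<bar>G W $$ (i, j) - gradient f W $$ (i, j)\<bar> \<le> \<delta>))"

definition bit_cube :: "nat \<Rightarrow> real vec set" where
  "bit_cube d = {x \<in> carrier_vec d. \<forall>j<d. x $ j \<in> {0, 1}}"

text \<open>
  The law of \<open>n\<close> i.i.d. uniform samples from the cube; outside \<open>{..<n}\<close> a sample sequence
  takes the dummy value \<open>0\<^sub>v d\<close>.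
\<close>

definition samples_pmf :: "nat \<Rightarrow> nat \<Rightarrow> (nat \<Rightarrow> real vec) pmf" where
  "samples_pmf d n = Pi_pmf {..<n} (0\<^sub>v d) (\<lambda>_. pmf_of_set (bit_cube d))"

definition data_mat :: "nat \<Rightarrow> nat \<Rightarrow> (nat \<Rightarrow> real vec) \<Rightarrow> real mat" where
  "data_mat d n x = mat n d (\<lambda>(l, j). x l $ j)"

text \<open>
  The map \<open>e\<close> enumerates the relevant bits; with 0-based indices, the paired elements
  \<open>j\<^sub>2\<^sub>i\<^sub>-\<^sub>1, j\<^sub>2\<^sub>i\<close> become \<open>e (2 * i)\<close> and \<open>e (2 * i + 1)\<close>.
\<close>

definition supervision_mat ::
    "nat \<Rightarrow> nat \<Rightarrow> (nat \<Rightarrow> nat) \<Rightarrow> (nat \<Rightarrow> real vec) \<Rightarrow> real mat" where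
  "supervision_mat n t e x = mat n t (\<lambda>(l, i). x l $ e (2 * i) * x l $ e (2 * i + 1))"

definition att :: "real mat \<Rightarrow> real mat \<Rightarrow> real mat" where
  "att W X = X * softmax W"

definition loss ::
    "nat \<Rightarrow> nat \<Rightarrow> nat \<Rightarrow> (nat \<Rightarrow> nat) \<Rightarrow> (nat \<Rightarrow> real vec) \<Rightarrow> real mat \<Rightarrow> real" where
  "loss d n t e x W =
     1 / (2 * real n) * (frobenius_norm (att W (data_mat d n x) - supervision_mat n t e x))\<^sup>2"

lemma loss_partial_differentiable:
  assumes "W \<in> carrier_mat d t" "d > 0"
  shows "(\<lambda>s. loss d n t e x (W + s \<cdot>\<^sub>m unit_mat d t i j)) field_differentiable at 0"
proof -
  let ?w = "\<lambda>s a m. W $$ (a, m) + s * (if (a, m) = (i, j) then 1 else 0)"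
  have eq: "(\<lambda>s. loss d n t e x (W + s \<cdot>\<^sub>m unit_mat d t i j)) =
    (\<lambda>s. 1 / (2 * real n) * (\<Sum>l<n. \<Sum>m<t.
       ((\<Sum>a<d. x l $ a * (exp (?w s a m) / (\<Sum>a<d. exp (?w s a m))))
        - x l $ e (2 * m) * x l $ e (2 * m + 1))\<^sup>2))"
    using assms(1)
    by (intro ext) (auto simp: loss_def frobenius_norm_def att_def data_mat_def
      supervision_mat_def softmax_def unit_mat_def scalar_prod_def sum_nonneg atLeast0LessThan
      intro!: sum.cong arg_cong[where f = "\<lambda>z. (z - _)\<^sup>2"] arg_cong2[where f = "(/)"])
  have ne: "(\<Sum>a<d. exp (?w s a m)) \<noteq> 0" for s m
    using sum_pos[of "{..<d}" "\<lambda>a. exp (?w s a m)"] assms(2) by fastforce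
  have w: "(\<lambda>s. exp (?w s a m)) field_differentiable at 0" for a m
    unfolding field_differentiable_def by (rule exI) (rule derivative_eq_intros refl)+
  show ?thesis
    unfolding eq using ne ne[of _ 0] w
    by (intro field_differentiable_mult field_differentiable_sum field_differentiable_power
        field_differentiable_diff field_differentiable_const field_differentiable_divide) auto
qed

end

theory Submission
  imports Defs "HOL-Probability.Hoeffding" "HOL-Real_Asymp.Real_Asymp"
begin

unbundle no vec_syntax

text \<open>
  At \<open>W = 0\<close> every column of the softmax is uniform, so the partial derivative in direction \<open>(j, m)\<close>
  is \<open>1/d\<close> times the sample mean of \<open>(z - x\<^sub>p x\<^sub>p') (x\<^sub>j - z)\<close>, where \<open>z\<close> is the average bit and
  \<open>p, p'\<close> is the \<open>m\<close>-th pair of relevant bits. The softmax only sees differences within a column,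
  and the difference between rows \<open>p\<close> and \<open>q\<close> has expectation exactly \<open>0\<close> if \<open>q\<close> lies in the pair
  and exactly \<open>-1/(8d)\<close> otherwise, since the contribution of \<open>z\<close> cancels by symmetry.
  By Hoeffding and a union bound over at most \<open>d\<^sup>2\<close> contrasts, all sample means are within
  \<open>d powr (-\<epsilon>/4)\<close> of their expectations. The step size turns the gap into \<open>d powr (\<epsilon>/8)\<close> and the noise
  into \<open>d powr (-\<epsilon>/8)\<close>, so that each column of the softmax puts mass close to \<open>1/2\<close> on each element of
  its pair and a negligible mass elsewhere.
\<close>

section \<open>Moments of uniform bits\<close>

text \<open>Identifying bit vectors with subsets of \<open>{..<d}\<close> turns expectations over
  the cube into counts of subsets.\<close>

lemma bit_cube_eq_image: "bit_cube d = indicator_vec d ` Pow {..<d}"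
proof (intro equalityI subsetI)
  fix x assume x: "x \<in> bit_cube d"
  then have "x = indicator_vec d {j. j < d \<and> x $ j = 1}"
    by (intro eq_vecI) (auto simp: bit_cube_def indicator_vec_def)
  then show "x \<in> indicator_vec d ` Pow {..<d}" by blast
qed (auto simp: bit_cube_def indicator_vec_def)

lemma inj_on_indicator_vec: "inj_on (indicator_vec d) (Pow {..<d})"
proof (rule inj_onI)
  fix S T assume "S \<in> Pow {..<d}" "T \<in> Pow {..<d}" and eq: "indicator_vec d S = indicator_vec d T"
  have "j \<in> S \<longleftrightarrow> j \<in> T" if "j < d" for j
    using arg_cong[OF eq, of "\<lambda>v. v $ j"] that by (simp add: indicator_vec_def split: if_splits)
  with \<open>S \<in> _\<close> \<open>T \<in> _\<close> show "S = T" by auto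
qed

lemma finite_bit_cube: "finite (bit_cube d)"
  by (simp add: bit_cube_eq_image)

lemma bit_cube_nonempty: "bit_cube d \<noteq> {}"
  by (auto simp: bit_cube_eq_image)

lemma set_bit_pmf: "set_pmf (pmf_of_set (bit_cube d)) = bit_cube d"
  by (simp add: finite_bit_cube bit_cube_nonempty)

lemma card_bit_cube: "card (bit_cube d) = 2 ^ d"
  by (simp add: bit_cube_eq_image card_image inj_on_indicator_vec card_Pow)

lemma integrable_bit_pmf: "integrable (measure_pmf (pmf_of_set (bit_cube d))) (f :: _ \<Rightarrow> real)"
  by (intro integrable_measure_pmf_finite) (simp add: set_bit_pmf finite_bit_cube)

lemma card_supersets:
  assumes "finite U" "A \<subseteq> U"
  shows "card {S. A \<subseteq> S \<and> S \<subseteq> U} = 2 ^ (card U - card A)"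
proof -
  have "bij_betw (\<lambda>S. S \<union> A) (Pow (U - A)) {S. A \<subseteq> S \<and> S \<subseteq> U}"
    by (rule bij_betwI[where g = "\<lambda>S. S - A"]) (use assms in auto)
  then have "card {S. A \<subseteq> S \<and> S \<subseteq> U} = card (Pow (U - A))"
    by (simp add: bij_betw_same_card)
  then show ?thesis
    using assms by (simp add: card_Pow card_Diff_subset finite_subset)
qed

text \<open>The product is 1 exactly when every bit indexed by \<open>A\<close> is set, so the sum
  over the cube counts the supersets of \<open>A\<close>.\<close>

lemma expectation_prod_bits:
  assumes "A \<subseteq> {..<d}"
  shows "measure_pmf.expectation (pmf_of_set (bit_cube d)) (\<lambda>x. \<Prod>j\<in>A. x $ j) = (1 / 2) ^ card A"
proof -
  have fin: "finite A" and le: "card A \<le> d"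
    using assms finite_subset card_mono[of "{..<d}" A] by auto
  have "(\<Sum>x\<in>bit_cube d. \<Prod>j\<in>A. x $ j)
      = (\<Sum>S\<in>Pow {..<d}. \<Prod>j\<in>A. indicator_vec d S $ j :: real)"
    by (simp add: bit_cube_eq_image sum.reindex inj_on_indicator_vec)
  also have "\<dots> = (\<Sum>S\<in>Pow {..<d}. if A \<subseteq> S then 1 else 0)"
  proof (intro sum.cong refl)
    fix S assume "S \<in> Pow {..<d}"
    have "(\<Prod>j\<in>A. indicator_vec d S $ j :: real) = (\<Prod>j\<in>A. if j \<in> S then 1 else 0)"
      using assms by (intro prod.cong) (auto simp: indicator_vec_def)
    then show "(\<Prod>j\<in>A. indicator_vec d S $ j :: real) = (if A \<subseteq> S then 1 else 0)"
      using fin by (cases "A \<subseteq> S") (auto simp: prod_zero_iff intro!: prod.neutral)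
  qed
  also have "\<dots> = real (card (Pow {..<d} \<inter> {S. A \<subseteq> S}))"
    by (simp flip: sum.inter_filter add: Int_def)
  also have "Pow {..<d} \<inter> {S. A \<subseteq> S} = {S. A \<subseteq> S \<and> S \<subseteq> {..<d}}" by auto
  also have "card \<dots> = 2 ^ (d - card A)" using assms by (simp add: card_supersets)
  finally have "(\<Sum>x\<in>bit_cube d. \<Prod>j\<in>A. x $ j) = (2 ^ (d - card A) :: real)" by simp
  then show ?thesis
    using le by (simp add: integral_pmf_of_set finite_bit_cube bit_cube_nonempty card_bit_cube
        power_diff power_one_over)
qed

text \<open>The indices may coincide. As bits are idempotent, repeated factors collapse, and only
  the number of distinct indices matters.\<close>

lemma expectation_three_bits:
  assumes "a < d" "b < d" "c < d"
  shows "measure_pmf.expectation (pmf_of_set (bit_cube d)) (\<lambda>x. x $ a * x $ b * x $ c)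
    = (1 / 2) ^ card {a, b, c}"
proof -
  have "measure_pmf.expectation (pmf_of_set (bit_cube d)) (\<lambda>x. x $ a * x $ b * x $ c)
      = measure_pmf.expectation (pmf_of_set (bit_cube d)) (\<lambda>x. \<Prod>j\<in>{a, b, c}. x $ j)"
  proof (intro integral_cong_AE AE_pmfI)
    fix x :: "real vec" assume "x \<in> set_pmf (pmf_of_set (bit_cube d))"
    then have "x $ a \<in> {0, 1}" "x $ b \<in> {0, 1}" "x $ c \<in> {0, 1}"
      using assms unfolding set_bit_pmf by (auto simp: bit_cube_def)
    then show "x $ a * x $ b * x $ c = (\<Prod>j\<in>{a, b, c}. x $ j)"
      by (auto simp: insert_absorb prod.insert_if)
  qed auto
  also have "\<dots> = (1 / 2) ^ card {a, b, c}"
    using assms by (intro expectation_prod_bits) auto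
  finally show ?thesis .
qed

section \<open>Contrasts between two rows of a gradient column\<close>

definition bit_mean :: "nat \<Rightarrow> real vec \<Rightarrow> real" where
  "bit_mean d x = (\<Sum>a<d. x $ a) / real d"

lemma bit_mean_bounds:
  assumes "x \<in> bit_cube d"
  shows "0 \<le> bit_mean d x" "bit_mean d x \<le> 1"
proof -
  have "0 \<le> x $ a \<and> x $ a \<le> 1" if "a < d" for a
    using assms that by (force simp: bit_cube_def)
  then have "0 \<le> (\<Sum>a<d. x $ a)" and le: "(\<Sum>a<d. x $ a) \<le> real d * 1"
    using sum_bounded_above[of "{..<d}" "\<lambda>a. x $ a" 1] by (auto intro: sum_nonneg)
  then show "0 \<le> bit_mean d x" by (simp add: bit_mean_def)
  show "bit_mean d x \<le> 1"
    using le by (cases "d = 0") (simp_all add: bit_mean_def)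
qed

text \<open>Up to the factor \<open>1/d\<close>, this is what one sample adds to the difference of
  the partial derivatives in rows \<open>p\<close> and \<open>q\<close>, in a column with pair
  \<open>p\<close>, \<open>p'\<close>. The common summand \<open>- bit_mean d x\<close> of the row
  factors has already cancelled.\<close>

definition contrast :: "nat \<Rightarrow> nat \<Rightarrow> nat \<Rightarrow> nat \<Rightarrow> real vec \<Rightarrow> real" where
  "contrast d p p' q x = (bit_mean d x - x $ p * x $ p') * (x $ p - x $ q)"

lemma contrast_bounds:
  assumes "x \<in> bit_cube d" "p < d" "p' < d" "q < d"
  shows "contrast d p p' q x \<in> {-1..1}"
proof -
  have "x $ p \<in> {0, 1}" "x $ p' \<in> {0, 1}" "x $ q \<in> {0, 1}"
    using assms by (auto simp: bit_cube_def)
  then show ?thesis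
    using bit_mean_bounds[OF assms(1)] by (auto simp: contrast_def)
qed

text \<open>The point is that the value is the same for every \<open>p\<close>, so the mean terms
  cancel in the expected contrast.\<close>

lemma expectation_bit_mean_mult:
  assumes "p < d"
  shows "measure_pmf.expectation (pmf_of_set (bit_cube d)) (\<lambda>x. bit_mean d x * x $ p)
    = (1 / 2 + real (d - 1) / 4) / real d"
proof -
  \<comment> \<open>The second factor \<open>x $ p\<close> is harmless for bits and brings each
    summand into the form of \<open>expectation_three_bits\<close>.\<close>
  have "measure_pmf.expectation (pmf_of_set (bit_cube d)) (\<lambda>x. bit_mean d x * x $ p)
      = measure_pmf.expectation (pmf_of_set (bit_cube d)) (\<lambda>x. (\<Sum>a<d. x $ a * x $ p * x $ p) / real d)"
  proof (intro integral_cong_AE AE_pmfI)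
    fix x :: "real vec" assume "x \<in> set_pmf (pmf_of_set (bit_cube d))"
    then have "x $ p \<in> {0, 1}"
      using assms unfolding set_bit_pmf by (auto simp: bit_cube_def)
    then show "bit_mean d x * x $ p = (\<Sum>a<d. x $ a * x $ p * x $ p) / real d"
      by (auto simp: bit_mean_def)
  qed auto
  also have "\<dots> = (\<Sum>a<d. (1 / 2) ^ card {a, p}) / real d"
    using assms by (simp add: Bochner_Integration.integral_sum integrable_bit_pmf expectation_three_bits)
  also have "(\<Sum>a<d. (1 / 2 :: real) ^ card {a, p}) = 1 / 2 + (\<Sum>a\<in>{..<d} - {p}. (1 / 2) ^ card {a, p})"
    using assms by (subst sum.remove[of _ p]) auto
  also have "(\<Sum>a\<in>{..<d} - {p}. (1 / 2 :: real) ^ card {a, p}) = (\<Sum>a\<in>{..<d} - {p}. 1 / 4)"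
    by (intro sum.cong refl) (auto simp: power2_eq_square)
  also have "\<dots> = real (d - 1) / 4" using assms by simp
  finally show ?thesis .
qed

text \<open>After the mean terms cancel, \<open>(1/2) ^ card {p, p', q} - 1/4\<close> remains:
  \<open>1/4 - 1/4\<close> for \<open>q\<close> in the pair and \<open>1/8 - 1/4\<close>
  otherwise.\<close>

lemma expectation_contrast:
  assumes "p < d" "p' < d" "q < d" "p \<noteq> p'"
  shows "measure_pmf.expectation (pmf_of_set (bit_cube d)) (contrast d p p' q)
    = (if q \<in> {p, p'} then 0 else - 1 / 8)"
proof -
  have "contrast d p p' q = (\<lambda>x. bit_mean d x * x $ p - bit_mean d x * x $ q
      - x $ p * x $ p' * x $ p + x $ p * x $ p' * x $ q)"
    by (auto simp: contrast_def algebra_simps)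
  then have "measure_pmf.expectation (pmf_of_set (bit_cube d)) (contrast d p p' q)
     = (1 / 2) ^ card {p, p', q} - (1 / 2) ^ card {p, p', p}"
    using assms by (simp add: integrable_bit_pmf expectation_bit_mean_mult expectation_three_bits)
  then show ?thesis using assms by (auto simp: insert_commute power2_eq_square power3_eq_cube)
qed

section \<open>Concentration of sample means\<close>

text \<open>Hoeffding's inequality for the sum, with deviation \<open>n * s\<close> and
  \<open>n\<close> ranges of width 2: the exponent is \<open>-2 (n s)^2 / (4 n)\<close>.\<close>

lemma sample_mean_concentration:
  fixes f :: "'a \<Rightarrow> real"
  assumes "n > 0" "s \<ge> 0" and f: "\<And>x. x \<in> set_pmf P \<Longrightarrow> f x \<in> {-1..1}"
  shows "measure_pmf.prob (Pi_pmf {..<n} dflt (\<lambda>_. P))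
      {x. s \<le> \<bar>(\<Sum>l<n. f (x l)) / real n - measure_pmf.expectation P f\<bar>}
    \<le> 2 * exp (- real n * s\<^sup>2 / 2)"
proof -
  let ?M = "Pi_pmf {..<n} dflt (\<lambda>_. P)"
  have comp: "map_pmf (\<lambda>x. x l) ?M = P" if "l < n" for l
    using that by (simp add: Pi_pmf_component)
  have E: "measure_pmf.expectation ?M (\<lambda>x. f (x l)) = measure_pmf.expectation P f" if "l < n" for l
    using comp[OF that] by (metis integral_map_pmf)
  have AE: "f (x l) \<in> {-1..1}" if "l < n" "x \<in> set_pmf ?M" for l x
    using that comp[OF that(1)] f by (metis imageI set_map_pmf)
  interpret Hoeffding_ineq "measure_pmf ?M" "{..<n}" "\<lambda>l x. f (x l)" "\<lambda>_. -1" "\<lambda>_. 1"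
    "real n * measure_pmf.expectation P f"
  proof unfold_locales
    show "prob_space.indep_vars (measure_pmf ?M) (\<lambda>_. borel) (\<lambda>l x. f (x l)) {..<n}"
      by (rule prob_space.indep_vars_compose2[OF _ indep_vars_Pi_pmf])
        (auto intro: measure_pmf.prob_space_axioms)
    show "AE x in measure_pmf ?M. f (x l) \<in> {-1..1}" if "l \<in> {..<n}" for l
      using that AE by (intro AE_pmfI) auto
  qed (auto simp: E)
  have "measure_pmf.prob ?M {x \<in> space (measure_pmf ?M).
      real n * s \<le> \<bar>(\<Sum>l<n. f (x l)) - real n * measure_pmf.expectation P f\<bar>}
      \<le> 2 * exp (- 2 * (real n * s)\<^sup>2 / (\<Sum>l<n. (1 - - 1)\<^sup>2))"
    by (rule Hoeffding_ineq_abs_ge) (use assms in auto)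
  moreover have "- 2 * (real n * s)\<^sup>2 / (\<Sum>l<n. (1 - - 1)\<^sup>2) = - real n * s\<^sup>2 / 2"
    using assms(1) by (simp add: power2_eq_square)
  moreover have "real n * s \<le> \<bar>S - real n * \<mu>\<bar> \<longleftrightarrow> s \<le> \<bar>S / real n - \<mu>\<bar>" for S \<mu> :: real
  proof -
    have "S - real n * \<mu> = real n * (S / real n - \<mu>)"
      using assms(1) by (simp add: right_diff_distrib)
    then show ?thesis using assms(1) by (simp only: abs_mult) simp
  qed
  ultimately show ?thesis by (simp only: space_measure_pmf UNIV_I simp_thms)
qed

section \<open>The gradient at the zero matrix\<close>

text \<open>At 0 all exponentials are 1 and the normaliser is \<open>d\<close>, so the quotient rule
  simplifies. The parameter \<open>c\<close> is a switch: 1 for the column being perturbed, 0 for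
  the columns left alone.\<close>

lemma DERIV_softmax_average:
  fixes x :: "nat \<Rightarrow> real"
  assumes "i < d"
  shows "((\<lambda>s. \<Sum>a<d. x a * (exp (s * (if a = i then c else 0)) / (\<Sum>a<d. exp (s * (if a = i then c else 0)))))
    has_real_derivative (c * (x i - (\<Sum>a<d. x a) / real d) / real d)) (at 0)"
proof -
  let ?u = "\<lambda>a. if a = i then c else 0"
  have "((\<lambda>s. \<Sum>a<d. x a * (exp (s * ?u a) / (\<Sum>a<d. exp (s * ?u a))))
    has_real_derivative (\<Sum>a<d. x a * ((?u a * real d - (\<Sum>a<d. ?u a)) / (real d * real d)))) (at 0)"
    using assms
    by (auto intro!: derivative_eq_intros sum.cong simp del: if_split simp: right_diff_distrib mult_ac)
  also have "(\<Sum>a<d. ?u a) = c" using assms by simp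
  also have "(\<Sum>a<d. x a * ((?u a * real d - c) / (real d * real d)))
      = (\<Sum>a<d. ?u a * x a / real d - x a * c / (real d * real d))"
  proof (intro sum.cong refl)
    have "y * ((v * real d - c) / (real d * real d)) = v * y / real d - y * c / (real d * real d)"
      for v y using assms by (simp add: field_simps)
    then show "x a * ((?u a * real d - c) / (real d * real d))
        = ?u a * x a / real d - x a * c / (real d * real d)" for a .
  qed
  also have "\<dots> = (\<Sum>a<d. ?u a * x a) / real d - (\<Sum>a<d. x a) * c / (real d * real d)"
    by (simp add: sum_subtractf sum_divide_distrib sum_distrib_right)
  also have "(\<Sum>a<d. ?u a * x a) = (\<Sum>a<d. if a = i then c * x a else 0)"
    by (intro sum.cong) auto
  also have "\<dots> = c * x i" using assms by simp
  finally show ?thesis by (simp add: algebra_simps diff_divide_distrib)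
qed

text \<open>Perturbing entry \<open>(i, j)\<close> changes only column \<open>j\<close> of the
  softmax, so only the summands with \<open>m = j\<close> have a nonzero derivative. The 2 from the
  square cancels the 2 in the loss.\<close>

lemma gradient_loss_zero:
  assumes "i < d" "j < t"
  shows "gradient (loss d n t e x) (0\<^sub>m d t) $$ (i, j) =
    (\<Sum>l<n. (bit_mean d (x l) - x l $ e (2 * j) * x l $ e (2 * j + 1))
        * (x l $ i - bit_mean d (x l))) / (real n * real d)"
proof -
  let ?u = "\<lambda>m a. if a = i then (if m = j then 1 else 0) else 0 :: real"
  let ?f = "\<lambda>l m s. (\<Sum>a<d. x l $ a * (exp (s * ?u m a) / (\<Sum>a<d. exp (s * ?u m a))))"
  let ?y = "\<lambda>l m. x l $ e (2 * m) * x l $ e (2 * m + 1)"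
  have eq: "(\<lambda>s. loss d n t e x (0\<^sub>m d t + s \<cdot>\<^sub>m unit_mat d t i j)) =
      (\<lambda>s. 1 / (2 * real n) * (\<Sum>l<n. \<Sum>m<t. (?f l m s - ?y l m)\<^sup>2))"
    using assms
    by (intro ext) (auto simp: loss_def frobenius_norm_def att_def data_mat_def
      supervision_mat_def softmax_def unit_mat_def scalar_prod_def sum_nonneg atLeast0LessThan
      intro!: sum.cong arg_cong[where f = "\<lambda>z. (z - _)\<^sup>2"] arg_cong2[where f = "(/)"])
  have f0: "?f l m 0 = bit_mean d (x l)" for l m
    by (simp add: bit_mean_def sum_divide_distrib)
  have f': "(?f l m has_real_derivative
      (if m = j then 1 else 0) * (x l $ i - bit_mean d (x l)) / real d) (at 0)" for l m
    using DERIV_softmax_average[OF assms(1), of "\<lambda>a. x l $ a" "if m = j then 1 else 0"]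
    by (simp add: bit_mean_def)
  have g': "((\<lambda>s. (?f l m s - ?y l m)\<^sup>2) has_real_derivative
      (if m = j then 2 * (bit_mean d (x l) - ?y l m) * (x l $ i - bit_mean d (x l)) / real d else 0))
      (at 0)" for l m
  proof -
    have "((\<lambda>s. (?f l m s - ?y l m)\<^sup>2) has_real_derivative
      2 * ((if m = j then 1 else 0) * (x l $ i - bit_mean d (x l)) / real d - 0) * (?f l m 0 - ?y l m)) (at 0)"
      using DERIV_power[OF DERIV_diff[OF f' DERIV_const], of l m "?y l m" 2] by (simp only: mult_ac) simp
    moreover have "2 * ((if m = j then 1 else 0) * (x l $ i - bit_mean d (x l)) / real d - 0) * (?f l m 0 - ?y l m)
      = (if m = j then 2 * (bit_mean d (x l) - ?y l m) * (x l $ i - bit_mean d (x l)) / real d else 0)"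
      unfolding f0 by (simp add: algebra_simps)
    ultimately show ?thesis by simp
  qed
  have "((\<lambda>s. 1 / (2 * real n) * (\<Sum>l<n. \<Sum>m<t. (?f l m s - ?y l m)\<^sup>2)) has_real_derivative
      1 / (2 * real n) * (\<Sum>l<n. \<Sum>m<t.
        (if m = j then 2 * (bit_mean d (x l) - ?y l m) * (x l $ i - bit_mean d (x l)) / real d else 0)))
      (at 0)"
    by (intro DERIV_cmult DERIV_sum g')
  then have "deriv (\<lambda>s. loss d n t e x (0\<^sub>m d t + s \<cdot>\<^sub>m unit_mat d t i j)) 0 =
      1 / (2 * real n) * (\<Sum>l<n. \<Sum>m<t.
        (if m = j then 2 * (bit_mean d (x l) - ?y l m) * (x l $ i - bit_mean d (x l)) / real d else 0))"
    unfolding eq by (rule DERIV_imp_deriv)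
  also have "\<dots> = 1 / (2 * real n) * (\<Sum>l<n.
      2 * ((bit_mean d (x l) - ?y l j) * (x l $ i - bit_mean d (x l))) / real d)"
    using assms(2)
    by (simp only: sum.delta finite_lessThan lessThan_iff if_True mult.assoc)
  also have "\<dots> = (\<Sum>l<n. (bit_mean d (x l) - ?y l j) * (x l $ i - bit_mean d (x l)))
      / (real n * real d)"
    by (simp flip: sum_divide_distrib sum_distrib_left)
  finally show ?thesis using assms by (simp add: gradient_def)
qed

section \<open>Softmax columns with two dominant entries\<close>

text \<open>Scaled so that row \<open>p\<close> has weight 1, row \<open>p'\<close> has weight
  within \<open>2 * \<tau>\<close> of 1 and the other rows have total weight at most
  \<open>d * exp (- B)\<close>. The normaliser is therefore close to 2, and it is at least 1, so
  dividing by it never enlarges an error.\<close>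

lemma softmax_two_dominant:
  fixes w :: "nat \<Rightarrow> real"
  assumes p: "p < d" "p' < d" "p \<noteq> p'"
    and tie: "\<bar>w p' - w p\<bar> \<le> \<tau>" "\<tau> \<le> 1"
    and rest: "\<And>q. q < d \<Longrightarrow> q \<notin> {p, p'} \<Longrightarrow> w q - w p \<le> - B"
  defines "\<sigma> \<equiv> \<lambda>q. exp (w q) / (\<Sum>i<d. exp (w i))"
  shows "\<bar>2 * \<sigma> p - 1\<bar> \<le> 2 * \<tau> + real d * exp (- B)"
    and "\<bar>2 * \<sigma> p' - 1\<bar> \<le> 2 * \<tau> + real d * exp (- B)"
    and "\<And>q. q < d \<Longrightarrow> q \<notin> {p, p'} \<Longrightarrow> \<sigma> q \<le> exp (- B)"
proof -
  define u where "u q = exp (w q - w p)" for q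
  define R where "R = (\<Sum>q\<in>{..<d} - {p, p'}. u q)"
  define S where "S = (\<Sum>q<d. u q)"
  have S: "S = 1 + u p' + R"
    using p unfolding S_def R_def
    by (subst sum.subset_diff[of "{p, p'}"]) (auto simp: u_def)
  have \<sigma>: "\<sigma> q = u q / S" for q
    by (simp add: \<sigma>_def u_def S_def exp_diff flip: sum_divide_distrib)
  have R0: "R \<ge> 0" unfolding R_def u_def by (intro sum_nonneg) auto
  have "R \<le> (\<Sum>q\<in>{..<d} - {p, p'}. exp (- B))"
    unfolding R_def u_def by (intro sum_mono) (use rest in auto)
  also have "\<dots> \<le> real d * exp (- B)"
    by (simp add: card_Diff_subset p)
  finally have R: "R \<le> real d * exp (- B)" .
  have u0: "u q > 0" for q by (simp add: u_def)
  \<comment> \<open>For a positive exponent \<open>z\<close>, the bound \<open>z \<le> 1\<close>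
    gives \<open>exp z \<le> 1 + z + z^2 \<le> 1 + 2 z\<close>; for a negative one,
    \<open>1 + z \<le> exp z \<le> 1\<close> suffices.\<close>
  have u: "\<bar>u p' - 1\<bar> \<le> 2 * \<tau>"
  proof (cases "w p' \<ge> w p")
    case True
    define z where "z = w p' - w p"
    have z: "0 \<le> z" "z \<le> \<tau>" "z \<le> 1" using True tie by (auto simp: z_def)
    have "exp z \<le> 1 + z + z\<^sup>2" using z by (intro exp_bound)
    moreover have "z\<^sup>2 \<le> z" using z by (simp add: power2_eq_square mult_left_le)
    moreover have "exp z \<ge> 1 + z" by simp
    ultimately show ?thesis using z unfolding u_def z_def[symmetric] by linarith
  next
    case False
    then show ?thesis
      using exp_ge_add_one_self[of "w p' - w p"] tie exp_le_one_iff[of "w p' - w p"]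
      unfolding u_def by linarith
  qed
  have div: "y / S \<le> y" if "y \<ge> 0" "S \<ge> 1" for y
    using that mult_left_mono[of 1 S y] by (simp add: divide_le_eq)
  have S1: "S \<ge> 1" using S R0 u0[of p'] by linarith
  have up: "u p = 1" by (simp add: u_def)
  have "\<bar>2 * \<sigma> p - 1\<bar> = \<bar>1 - u p' - R\<bar> / S"
    using S1 by (simp add: \<sigma> up S field_simps)
  also have "\<dots> \<le> \<bar>1 - u p' - R\<bar>"
    using S1 by (intro div) auto
  also have "\<dots> \<le> 2 * \<tau> + real d * exp (- B)" using u R R0 by linarith
  finally show "\<bar>2 * \<sigma> p - 1\<bar> \<le> 2 * \<tau> + real d * exp (- B)" .
  have "\<bar>2 * \<sigma> p' - 1\<bar> = \<bar>u p' - 1 - R\<bar> / S"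
    using S1 by (simp add: \<sigma> S field_simps)
  also have "\<dots> \<le> \<bar>u p' - 1 - R\<bar>"
    using S1 by (intro div) auto
  also have "\<dots> \<le> 2 * \<tau> + real d * exp (- B)" using u R R0 by linarith
  finally show "\<bar>2 * \<sigma> p' - 1\<bar> \<le> 2 * \<tau> + real d * exp (- B)" .
  fix q assume q: "q < d" "q \<notin> {p, p'}"
  have "\<sigma> q \<le> u q" using S1 u0[of q] div[of "u q"] by (simp add: \<sigma>)
  also have "\<dots> \<le> exp (- B)" using rest[OF q] by (simp add: u_def)
  finally show "\<sigma> q \<le> exp (- B)" .
qed

text \<open>The element at position \<open>i\<close> belongs to pair \<open>i div 2\<close>.
  Evenness of \<open>k\<close> leaves no position unpaired, and injectivity of \<open>e\<close>
  makes the pair unique.\<close>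

lemma paired_enumeration:
  fixes e :: "nat \<Rightarrow> nat"
  assumes "bij_betw e {..<k} b" "even k" "j \<in> b"
  obtains m where "m < k div 2" "j \<in> {e (2 * m), e (2 * m + 1)}"
    "\<And>m'. m' < k div 2 \<Longrightarrow> m' \<noteq> m \<Longrightarrow> j \<notin> {e (2 * m'), e (2 * m' + 1)}"
proof -
  obtain i where i: "i < k" "j = e i" using assms unfolding bij_betw_def by auto
  have inj: "e a = e c \<longleftrightarrow> a = c" if "a < k" "c < k" for a c
    using assms(1) that unfolding bij_betw_def inj_on_def by blast
  show thesis
  proof (rule that[of "i div 2"])
    show "i div 2 < k div 2" using i(1) assms(2) by presburger
    have "i = 2 * (i div 2) \<or> i = 2 * (i div 2) + 1" by presburger
    then show "j \<in> {e (2 * (i div 2)), e (2 * (i div 2) + 1)}" using i(2) by auto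
    fix m assume m: "m < k div 2" "m \<noteq> i div 2"
    then have "2 * m < k" "2 * m + 1 < k" "i \<noteq> 2 * m" "i \<noteq> 2 * m + 1"
      using assms(2) by presburger+
    then show "j \<notin> {e (2 * m), e (2 * m + 1)}" using i inj by auto
  qed
qed

text \<open>A relevant row is dominant in exactly one column, where it has mass near
  \<open>1/2\<close>, hence the factor 2 in front of the softmax. In all other columns, and for
  irrelevant rows in every column, its mass is at most \<open>exp (- B)\<close>.\<close>

lemma linf_norm_softmax_indicator_le:
  assumes W: "W \<in> carrier_mat d (k div 2)" and d: "d > 0" "k \<le> d" and k: "even k"
    and b: "b \<subseteq> {..<d}" "bij_betw e {..<k} b"
    and tie: "\<And>m. m < k div 2 \<Longrightarrow> \<bar>W $$ (e (2 * m + 1), m) - W $$ (e (2 * m), m)\<bar> \<le> \<tau>" "\<tau> \<le> 1"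
    and rest: "\<And>m q. m < k div 2 \<Longrightarrow> q < d \<Longrightarrow> q \<notin> {e (2 * m), e (2 * m + 1)}
      \<Longrightarrow> W $$ (q, m) - W $$ (e (2 * m), m) \<le> - B"
    and \<tau>: "\<tau> \<ge> 0"
  shows "linf_norm (2 \<cdot>\<^sub>v (softmax W *\<^sub>v all_ones (k div 2)) - indicator_vec d b)
    \<le> 2 * \<tau> + 3 * (real d * exp (- B))"
proof -
  define \<sigma> where "\<sigma> m q = exp (W $$ (q, m)) / (\<Sum>i<d. exp (W $$ (i, m)))" for m q
  define t where "t = k div 2"
  have entry: "(2 \<cdot>\<^sub>v (softmax W *\<^sub>v all_ones t) - indicator_vec d b) $ j
      = 2 * (\<Sum>m<t. \<sigma> m j) - (if j \<in> b then 1 else 0)" if "j < d" for j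
    using W that by (simp add: t_def softmax_def all_ones_def indicator_vec_def scalar_prod_def
        \<sigma>_def atLeast0LessThan)
  have dim: "dim_vec (2 \<cdot>\<^sub>v (softmax W *\<^sub>v all_ones t) - indicator_vec d b) = d"
    by (simp add: indicator_vec_def)
  have e_less: "e i < d" if "i < k" for i
    using b that unfolding bij_betw_def by auto
  have e_neq: "e (2 * m) \<noteq> e (2 * m + 1)" if "m < t" for m
    using b(2) that unfolding bij_betw_def inj_on_def t_def by force
  have pair_less: "e (2 * m) < d" "e (2 * m + 1) < d" if "m < t" for m
    using that k by (auto simp: t_def intro!: e_less elim!: evenE)
  have \<sigma>0: "\<sigma> m q \<ge> 0" for m q
    unfolding \<sigma>_def by (intro divide_nonneg_nonneg sum_nonneg) auto
  have dom: "\<bar>2 * \<sigma> m (e (2 * m)) - 1\<bar> \<le> 2 * \<tau> + real d * exp (- B)"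
      "\<bar>2 * \<sigma> m (e (2 * m + 1)) - 1\<bar> \<le> 2 * \<tau> + real d * exp (- B)"
      "\<And>q. q < d \<Longrightarrow> q \<notin> {e (2 * m), e (2 * m + 1)} \<Longrightarrow> \<sigma> m q \<le> exp (- B)"
    if "m < t" for m
  proof -
    have "\<bar>W $$ (e (2 * m + 1), m) - W $$ (e (2 * m), m)\<bar> \<le> \<tau>"
      using tie(1) that by (simp add: t_def)
    moreover have "W $$ (q, m) - W $$ (e (2 * m), m) \<le> - B"
      if "q < d" "q \<notin> {e (2 * m), e (2 * m + 1)}" for q
      using rest that \<open>m < t\<close> by (simp add: t_def)
    ultimately show "\<bar>2 * \<sigma> m (e (2 * m)) - 1\<bar> \<le> 2 * \<tau> + real d * exp (- B)"
      "\<bar>2 * \<sigma> m (e (2 * m + 1)) - 1\<bar> \<le> 2 * \<tau> + real d * exp (- B)"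
      "\<And>q. q < d \<Longrightarrow> q \<notin> {e (2 * m), e (2 * m + 1)} \<Longrightarrow> \<sigma> m q \<le> exp (- B)"
      using softmax_two_dominant[of "e (2 * m)" d "e (2 * m + 1)" "\<lambda>q. W $$ (q, m)" \<tau> B]
        pair_less[OF that] e_neq[OF that] tie(2) unfolding \<sigma>_def by blast+
  qed
  have small: "\<sigma> m q \<le> exp (- B)" if "m < t" "q < d" "q \<notin> {e (2 * m), e (2 * m + 1)}" for m q
    using dom(3)[OF that] .
  have big: "\<bar>2 * \<sigma> m q - 1\<bar> \<le> 2 * \<tau> + real d * exp (- B)"
    if "m < t" "q \<in> {e (2 * m), e (2 * m + 1)}" for m q
    using dom(1,2)[OF that(1)] that(2) by auto
  have tail: "0 \<le> (\<Sum>m\<in>M. \<sigma> m j) \<and> (\<Sum>m\<in>M. \<sigma> m j) \<le> real d * exp (- B)"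
    if "M \<subseteq> {..<t}" "j < d" "\<And>m. m \<in> M \<Longrightarrow> j \<notin> {e (2 * m), e (2 * m + 1)}" for M j
  proof
    show "0 \<le> (\<Sum>m\<in>M. \<sigma> m j)" by (intro sum_nonneg \<sigma>0)
    have "(\<Sum>m\<in>M. \<sigma> m j) \<le> (\<Sum>m\<in>M. exp (- B))"
      by (intro sum_mono small) (use that in auto)
    also have "\<dots> = real (card M) * exp (- B)" by simp
    also have "card M \<le> d"
      using card_mono[OF _ that(1)] d(2) by (simp add: t_def)
    finally show "(\<Sum>m\<in>M. \<sigma> m j) \<le> real d * exp (- B)" by simp
  qed
  have "\<bar>(2 \<cdot>\<^sub>v (softmax W *\<^sub>v all_ones t) - indicator_vec d b) $ j\<bar>
      \<le> 2 * \<tau> + 3 * (real d * exp (- B))" if j: "j < d" for j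
  proof (cases "j \<in> b")
    case True
    obtain m where m: "m < t" "j \<in> {e (2 * m), e (2 * m + 1)}"
        "\<And>m'. m' < t \<Longrightarrow> m' \<noteq> m \<Longrightarrow> j \<notin> {e (2 * m'), e (2 * m' + 1)}"
      using paired_enumeration[OF b(2) k True] unfolding t_def by metis
    have "(\<Sum>m<t. \<sigma> m j) = \<sigma> m j + (\<Sum>m\<in>{..<t} - {m}. \<sigma> m j)"
      using m(1) by (subst sum.remove[of _ m]) auto
    moreover have "0 \<le> (\<Sum>m\<in>{..<t} - {m}. \<sigma> m j)"
      "(\<Sum>m\<in>{..<t} - {m}. \<sigma> m j) \<le> real d * exp (- B)"
      using tail[of "{..<t} - {m}" j] m j by auto
    \<comment> \<open>The 3 counts one \<open>Y\<close> for the dominant column and two for the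
      doubled tail \<open>R\<close>.\<close>
    moreover have "\<bar>2 * (a + R) - 1\<bar> \<le> T + 3 * Y"
      if "\<bar>2 * a - 1\<bar> \<le> T + Y" "0 \<le> R" "R \<le> Y" for a R T Y :: real
      using that by (simp add: abs_le_iff)
    ultimately show ?thesis
      unfolding entry[OF j] if_P[OF True] using big[OF m(1,2)] by metis
  next
    case False
    have "0 \<le> (\<Sum>m<t. \<sigma> m j) \<and> (\<Sum>m<t. \<sigma> m j) \<le> real d * exp (- B)"
    proof (intro tail j)
      fix m assume "m \<in> {..<t}"
      then have "2 * m < k" "2 * m + 1 < k" using k by (auto simp: t_def elim!: evenE)
      then show "j \<notin> {e (2 * m), e (2 * m + 1)}"
        using False b(2) unfolding bij_betw_def by auto
    qed simp
    then show ?thesis unfolding entry[OF j] using False \<tau> by simp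
  qed
  then show ?thesis
    using d(1) unfolding linf_norm_def t_def[symmetric] dim
    by (intro Max.boundedI) (auto simp del: index_minus_vec)
qed

section \<open>One approximate gradient step\<close>

lemma gradient_difference:
  assumes "d > 0" "n > 0" "m < t" "e (2 * m) < d" "q < d"
  shows "gradient (loss d n t e x) (0\<^sub>m d t) $$ (e (2 * m), m) - gradient (loss d n t e x) (0\<^sub>m d t) $$ (q, m)
    = (\<Sum>l<n. contrast d (e (2 * m)) (e (2 * m + 1)) q (x l)) / real n / real d"
proof -
  define r where "r l = bit_mean d (x l) - x l $ e (2 * m) * x l $ e (2 * m + 1)" for l
  have "(\<Sum>l<n. r l * (x l $ e (2 * m) - bit_mean d (x l)))
      - (\<Sum>l<n. r l * (x l $ q - bit_mean d (x l)))
    = (\<Sum>l<n. r l * (x l $ e (2 * m) - bit_mean d (x l)) - r l * (x l $ q - bit_mean d (x l)))"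
    by (rule sum_subtractf[symmetric])
  also have "\<dots> = (\<Sum>l<n. contrast d (e (2 * m)) (e (2 * m + 1)) q (x l))"
    by (intro sum.cong refl) (simp add: contrast_def r_def algebra_simps)
  finally show ?thesis
    using assms unfolding r_def by (simp add: gradient_loss_zero flip: diff_divide_distrib)
qed

text \<open>Row \<open>e (2 * m)\<close> serves as the reference row, since softmax depends only on
  differences within a column. Descent reverses the order of the rows, so a negative
  \<open>\<mu>\<close> pushes row \<open>q\<close> below the reference. The error
  \<open>\<delta>\<close> enters twice, once per row.\<close>

lemma gradient_step_entries:
  fixes x :: "nat \<Rightarrow> real vec"
  assumes "d > 0" "n > 0" "m < t" and less: "e (2 * m) < d" "q < d"
    and approx: "approx_gradient_oracle \<delta> d t (loss d n t e x) G"
    and \<eta>: "\<eta> \<ge> 0"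
    and conc: "\<bar>(\<Sum>l<n. contrast d (e (2 * m)) (e (2 * m + 1)) q (x l)) / real n - \<mu>\<bar> \<le> s"
  defines "W \<equiv> 0\<^sub>m d t - \<eta> \<cdot>\<^sub>m G (0\<^sub>m d t)"
  shows "\<bar>W $$ (q, m) - W $$ (e (2 * m), m) - \<eta> / real d * \<mu>\<bar> \<le> \<eta> / real d * s + 2 * \<eta> * \<delta>"
proof -
  define g where "g = gradient (loss d n t e x) (0\<^sub>m d t)"
  define H where "H = G (0\<^sub>m d t)"
  have H: "H \<in> carrier_mat d t"
    and close: "\<And>i j. i < d \<Longrightarrow> j < t \<Longrightarrow> \<bar>H $$ (i, j) - g $$ (i, j)\<bar> \<le> \<delta>"
    using approx unfolding approx_gradient_oracle_def H_def g_def by auto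
  define p where "p = e (2 * m)"
  define D where "D = (\<Sum>l<n. contrast d p (e (2 * m + 1)) q (x l)) / real n"
  have D: "g $$ (p, m) - g $$ (q, m) = D / real d"
    using gradient_difference[of d n m t e q x] assms(1-3) less by (simp add: g_def D_def p_def)
  have W: "W $$ (i, m) = - \<eta> * H $$ (i, m)" if "i < d" for i
    using H that assms(3) by (simp add: W_def H_def[symmetric])
  have "W $$ (q, m) - W $$ (p, m) - \<eta> / real d * \<mu>
      = \<eta> / real d * (D - \<mu>) + \<eta> * (H $$ (p, m) - g $$ (p, m)) - \<eta> * (H $$ (q, m) - g $$ (q, m))"
  proof -
    have "\<eta> / real d * (D - \<mu>) = \<eta> * (D / real d) - \<eta> / real d * \<mu>"
      by (simp add: right_diff_distrib)
    also have "\<dots> = \<eta> * (g $$ (p, m) - g $$ (q, m)) - \<eta> / real d * \<mu>" by (simp add: D)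
    finally show ?thesis using less by (simp add: W p_def algebra_simps)
  qed
  moreover have "\<bar>\<eta> / real d * (D - \<mu>)\<bar> \<le> \<eta> / real d * s"
    using conc \<eta> unfolding abs_mult D_def p_def by (simp add: divide_right_mono mult_left_mono)
  moreover have err: "\<bar>\<eta> * (H $$ (i, m) - g $$ (i, m))\<bar> \<le> \<eta> * \<delta>" if "i < d" for i
    using close[OF that assms(3)] \<eta> by (simp add: abs_mult mult_left_mono)
  moreover have "\<bar>a + b - c\<bar> \<le> u + 2 * v" if "\<bar>a\<bar> \<le> u" "\<bar>b\<bar> \<le> v" "\<bar>c\<bar> \<le> v" for a b c u v :: real
    using that by linarith
  ultimately show ?thesis using less unfolding p_def by (simp only: mult.assoc)
qed

section \<open>Growth rates and the union bound\<close>

text \<open>In order: the tie tolerance falls below 1, as the softmax estimate requires; the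
  off-pair mass becomes negligible; the union bound factor is absorbed by halving the exponent from
  \<open>\<nu> / 2\<close> to \<open>\<nu> / 4\<close>.\<close>

lemma eventually_threshold:
  fixes \<epsilon> \<nu> \<gamma> \<Gamma> :: real
  assumes "\<epsilon> > 0" "\<nu> > 0" "\<gamma> > 0" "\<Gamma> > 0"
  shows "eventually (\<lambda>d::nat. \<Gamma> * real d powr (- (\<epsilon> / 8)) \<le> 1
    \<and> real d * exp (- (\<gamma> * real d powr (\<epsilon> / 8) / 8 - 1)) \<le> real d powr (- (\<epsilon> / 8))
    \<and> 2 * (real d)\<^sup>2 * exp (- (\<nu> / 2 * real d powr (\<epsilon> / 2))) \<le> exp (- (\<nu> / 4) * real d powr (\<epsilon> / 2)))
    at_top"
  using assms by (intro eventually_conj; real_asymp)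

text \<open>Sampling noise and oracle error both perturb the gradient at order
  \<open>d powr (- 1 - \<epsilon> / 4)\<close>, and the step size multiplies this by at most order
  \<open>d powr (1 + \<epsilon> / 8)\<close>. In \<open>1 + 2 * \<kappa>\<close> the 1 stands for
  sampling and \<open>2 * \<kappa>\<close> for the two oracle errors.\<close>

lemma step_noise_le:
  fixes d :: nat
  assumes "d > 0" "0 \<le> \<eta>" "\<eta> \<le> \<gamma> * real d powr (1 + \<epsilon> / 8)"
    and \<delta>: "\<delta> \<le> \<kappa> * real d powr (- 1 - \<epsilon> / 4)" and "\<kappa> \<ge> 0"
  shows "\<eta> / real d * real d powr (- (\<epsilon> / 4)) + 2 * \<eta> * \<delta>
    \<le> \<gamma> * (1 + 2 * \<kappa>) * real d powr (- (\<epsilon> / 8))"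
proof -
  have scale: "real d powr (1 + \<epsilon> / 8) * real d powr (- 1 - \<epsilon> / 4) = real d powr (- (\<epsilon> / 8))"
    by (simp flip: powr_add)
  have inv: "real d powr (- (\<epsilon> / 4)) / real d = real d powr (- 1 - \<epsilon> / 4)"
    using assms(1) powr_add[of "real d" "- 1" "- (\<epsilon> / 4)"] by (simp add: powr_minus divide_simps mult_ac)
  have "2 * \<eta> * \<delta> \<le> 2 * \<eta> * (\<kappa> * real d powr (- 1 - \<epsilon> / 4))"
    using \<delta> assms(2) by (intro mult_left_mono) auto
  moreover have "\<eta> / real d * real d powr (- (\<epsilon> / 4)) = \<eta> * real d powr (- 1 - \<epsilon> / 4)"
    by (simp flip: inv)
  ultimately have "\<eta> / real d * real d powr (- (\<epsilon> / 4)) + 2 * \<eta> * \<delta>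
      \<le> \<eta> * ((1 + 2 * \<kappa>) * real d powr (- 1 - \<epsilon> / 4))"
    by (simp add: algebra_simps)
  also have "\<dots> \<le> \<gamma> * real d powr (1 + \<epsilon> / 8) * ((1 + 2 * \<kappa>) * real d powr (- 1 - \<epsilon> / 4))"
    using assms by (intro mult_right_mono) auto
  also have "\<dots> = \<gamma> * (1 + 2 * \<kappa>) * (real d powr (1 + \<epsilon> / 8) * real d powr (- 1 - \<epsilon> / 4))"
    by simp
  finally show ?thesis by (simp only: scale)
qed

text \<open>A union bound over the columns \<open>m\<close> and rows \<open>q\<close>; there are
  \<open>t * d\<close> events, at most \<open>d^2\<close>.\<close>

lemma contrast_concentration:
  assumes "n > 0" "s \<ge> 0" "t \<le> d" and less: "\<And>i. i < 2 * t \<Longrightarrow> e i < d"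
    and neq: "\<And>m. m < t \<Longrightarrow> e (2 * m) \<noteq> e (2 * m + 1)"
  shows "measure_pmf.prob (samples_pmf d n) {x. \<exists>m<t. \<exists>q<d.
      s \<le> \<bar>(\<Sum>l<n. contrast d (e (2 * m)) (e (2 * m + 1)) q (x l)) / real n
        - (if q \<in> {e (2 * m), e (2 * m + 1)} then 0 else - 1 / 8)\<bar>}
    \<le> 2 * (real d)\<^sup>2 * exp (- real n * s\<^sup>2 / 2)"
proof -
  define A where "A = (\<lambda>(m, q). {x. s \<le> \<bar>(\<Sum>l<n. contrast d (e (2 * m)) (e (2 * m + 1)) q (x l)) / real n
        - (if q \<in> {e (2 * m), e (2 * m + 1)} then 0 else - 1 / 8)\<bar>})"
  have single: "measure_pmf.prob (samples_pmf d n) (A z) \<le> 2 * exp (- real n * s\<^sup>2 / 2)"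
    if "z \<in> {..<t} \<times> {..<d}" for z
  proof -
    obtain m q where z: "z = (m, q)" "m < t" "q < d" using \<open>z \<in> _\<close> by blast
    have lt: "e (2 * m) < d" "e (2 * m + 1) < d" using z by (auto intro!: less)
    show ?thesis
      using sample_mean_concentration[OF assms(1,2), of "pmf_of_set (bit_cube d)"
          "contrast d (e (2 * m)) (e (2 * m + 1)) q" "0\<^sub>v d"]
        contrast_bounds[OF _ lt z(3)]
      unfolding set_bit_pmf expectation_contrast[OF lt z(3) neq[OF z(2)]] A_def samples_pmf_def z(1)
      by simp
  qed
  have "measure_pmf.prob (samples_pmf d n) (\<Union>z\<in>{..<t} \<times> {..<d}. A z)
      \<le> (\<Sum>z\<in>{..<t} \<times> {..<d}. measure_pmf.prob (samples_pmf d n) (A z))"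
    by (intro measure_pmf.finite_measure_subadditive_finite) auto
  also have "\<dots> \<le> (\<Sum>z\<in>{..<t} \<times> {..<d}. 2 * exp (- real n * s\<^sup>2 / 2))"
    by (intro sum_mono single)
  also have "\<dots> = real t * real d * (2 * exp (- real n * s\<^sup>2 / 2))"
    by (simp add: card_cartesian_product)
  also have "\<dots> \<le> real d * real d * (2 * exp (- real n * s\<^sup>2 / 2))"
    using assms(3) by (intro mult_right_mono) auto
  finally have "measure_pmf.prob (samples_pmf d n) (\<Union>z\<in>{..<t} \<times> {..<d}. A z)
      \<le> 2 * (real d)\<^sup>2 * exp (- real n * s\<^sup>2 / 2)"
    by (simp add: power2_eq_square)
  moreover have "(\<Union>z\<in>{..<t} \<times> {..<d}. A z) = {x. \<exists>m<t. \<exists>q<d.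
      s \<le> \<bar>(\<Sum>l<n. contrast d (e (2 * m)) (e (2 * m + 1)) q (x l)) / real n
        - (if q \<in> {e (2 * m), e (2 * m + 1)} then 0 else - 1 / 8)\<bar>}"
    by (force simp: A_def)
  ultimately show ?thesis by simp
qed

section \<open>Assembly of the bounds\<close>

text \<open>The constants are chosen before \<open>b\<close>, \<open>e\<close> and all other
  instance data, which gives the required uniformity. The oracle \<open>G\<close> takes the sample
  as an argument because the loss depends on it.\<close>

theorem theorem4p1:
  fixes \<epsilon> \<alpha>\<^sub>1 \<alpha>\<^sub>2 \<nu> \<kappa> \<gamma>\<^sub>1 \<gamma>\<^sub>2 :: real
  assumes "\<epsilon> > 0"
    and "\<alpha>\<^sub>1 > 0" "\<alpha>\<^sub>2 > 0" "\<nu> > 0" "\<kappa> > 0" "\<gamma>\<^sub>1 > 0" "\<gamma>\<^sub>2 > 0"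
  shows "\<exists>c>0. \<exists>C>0. \<exists>d\<^sub>0>0. \<forall>d\<ge>d\<^sub>0.
    \<forall>(k::nat) (t::nat) (n::nat) (b::nat set) (e::nat \<Rightarrow> nat) (\<delta>::real) (\<eta>::real)
      (G :: (nat \<Rightarrow> real vec) \<Rightarrow> real mat \<Rightarrow> real mat).
      even k \<longrightarrow> k \<le> d \<longrightarrow> \<alpha>\<^sub>1 * real d \<le> real k \<longrightarrow> real k \<le> \<alpha>\<^sub>2 * real d \<longrightarrow>
      t = k div 2 \<longrightarrow>
      \<nu> * real d powr \<epsilon> \<le> real n \<longrightarrow>
      b \<subseteq> {..<d} \<longrightarrow> card b = k \<longrightarrow> bij_betw e {..<k} b \<longrightarrow>
      \<delta> \<le> \<kappa> * real d powr (- 1 - \<epsilon> / 4) \<longrightarrow>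
      (\<forall>x \<in> set_pmf (samples_pmf d n).
         approx_gradient_oracle \<delta> d t (loss d n t e x) (G x)) \<longrightarrow>
      \<gamma>\<^sub>1 * real d powr (1 + \<epsilon> / 8) \<le> \<eta> \<longrightarrow> \<eta> \<le> \<gamma>\<^sub>2 * real d powr (1 + \<epsilon> / 8) \<longrightarrow>
      measure_pmf.prob (samples_pmf d n)
        {x. let W0 = 0\<^sub>m d t; W1 = W0 - \<eta> \<cdot>\<^sub>m G x W0 in
            linf_norm (2 \<cdot>\<^sub>v (softmax W1 *\<^sub>v all_ones t) - indicator_vec d b)
              \<le> C * real d powr (- (\<epsilon> / 8))}
      \<ge> 1 - exp (- c * real d powr (\<epsilon> / 2))"
proof -
  define \<Gamma> where "\<Gamma> = \<gamma>\<^sub>2 * (1 + 2 * \<kappa>)"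
  have \<Gamma>: "\<Gamma> > 0" using assms unfolding \<Gamma>_def by (intro mult_pos_pos) auto
  obtain N where N: "\<And>d. d \<ge> N \<Longrightarrow> \<Gamma> * real d powr (- (\<epsilon> / 8)) \<le> 1
    \<and> real d * exp (- (\<gamma>\<^sub>1 * real d powr (\<epsilon> / 8) / 8 - 1)) \<le> real d powr (- (\<epsilon> / 8))
    \<and> 2 * (real d)\<^sup>2 * exp (- (\<nu> / 2 * real d powr (\<epsilon> / 2))) \<le> exp (- (\<nu> / 4) * real d powr (\<epsilon> / 2))"
    using eventually_threshold[OF assms(1,4,6) \<Gamma>] unfolding eventually_at_top_linorder by blast
  have main: "measure_pmf.prob (samples_pmf d n)
      {x. let W0 = 0\<^sub>m d t; W1 = W0 - \<eta> \<cdot>\<^sub>m G x W0 in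
          linf_norm (2 \<cdot>\<^sub>v (softmax W1 *\<^sub>v all_ones t) - indicator_vec d b)
            \<le> (2 * \<Gamma> + 3) * real d powr (- (\<epsilon> / 8))}
    \<ge> 1 - exp (- (\<nu> / 4) * real d powr (\<epsilon> / 2))"
    if d: "d \<ge> max 1 N" and k: "even k" "k \<le> d" and t: "t = k div 2"
      and n: "\<nu> * real d powr \<epsilon> \<le> real n"
      and b: "b \<subseteq> {..<d}" "bij_betw e {..<k} b"
      and \<delta>: "\<delta> \<le> \<kappa> * real d powr (- 1 - \<epsilon> / 4)"
      and G: "\<forall>x \<in> set_pmf (samples_pmf d n).
         approx_gradient_oracle \<delta> d t (loss d n t e x) (G x)"
      and \<eta>: "\<gamma>\<^sub>1 * real d powr (1 + \<epsilon> / 8) \<le> \<eta>" "\<eta> \<le> \<gamma>\<^sub>2 * real d powr (1 + \<epsilon> / 8)"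
    for d k t n :: nat and b e \<delta> \<eta> and G :: "(nat \<Rightarrow> real vec) \<Rightarrow> real mat \<Rightarrow> real mat"
  proof -
    have d0: "d > 0" using d by simp
    have "0 < \<nu> * real d powr \<epsilon>" using assms(4) d0 by simp
    then have n0: "n > 0" using n by (cases n) auto
    have \<eta>0: "\<eta> \<ge> 0" using \<eta>(1) assms(6) by (smt (verit) mult_nonneg_nonneg powr_ge_zero)
    define \<tau> where "\<tau> = \<Gamma> * real d powr (- (\<epsilon> / 8))"
    \<comment> \<open>The gap \<open>\<eta> / d / 8\<close> is at least
      \<open>\<gamma>\<^sub>1 * real d powr (\<epsilon> / 8) / 8\<close>; the subtracted 1 pays for
      the noise \<open>\<tau> \<le> 1\<close>.\<close>
    define B where "B = \<gamma>\<^sub>1 * real d powr (\<epsilon> / 8) / 8 - 1"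
    \<comment> \<open>This tolerance makes \<open>n * s^2\<close> at least
      \<open>\<nu> * real d powr (\<epsilon> / 2)\<close>, which is the exponent in the failure
      probability.\<close>
    define s where "s = real d powr (- (\<epsilon> / 4))"
    have \<tau>: "0 \<le> \<tau>" "\<tau> \<le> 1" using N[of d] d \<Gamma> by (auto simp: \<tau>_def)
    have B: "real d * exp (- B) \<le> real d powr (- (\<epsilon> / 8))" using N[of d] d by (simp add: B_def)
    have noise: "\<eta> / real d * s + 2 * \<eta> * \<delta> \<le> \<tau>"
      unfolding s_def \<tau>_def \<Gamma>_def
      by (rule step_noise_le[OF d0 \<eta>0 \<eta>(2) \<delta>]) (use assms in simp)
    have less: "e i < d" if "i < 2 * t" for i
    proof -
      have "i < k" using that t by linarith
      then show ?thesis using b unfolding bij_betw_def by auto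
    qed
    have neq: "e (2 * m) \<noteq> e (2 * m + 1)" if "m < t" for m
      using b(2) that t unfolding bij_betw_def inj_on_def by force
    define \<mu> :: "nat \<Rightarrow> nat \<Rightarrow> real"
      where "\<mu> m q = (if q \<in> {e (2 * m), e (2 * m + 1)} then 0 else - 1 / 8)" for m q
    define bad where "bad = {x. \<exists>m<t. \<exists>q<d.
      s \<le> \<bar>(\<Sum>l<n. contrast d (e (2 * m)) (e (2 * m + 1)) q (x l)) / real n - \<mu> m q\<bar>}"
    define good where "good = {x. let W0 = 0\<^sub>m d t; W1 = W0 - \<eta> \<cdot>\<^sub>m G x W0 in
          linf_norm (2 \<cdot>\<^sub>v (softmax W1 *\<^sub>v all_ones t) - indicator_vec d b)
            \<le> (2 * \<Gamma> + 3) * real d powr (- (\<epsilon> / 8))}"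
    have "measure_pmf.prob (samples_pmf d n) bad \<le> 2 * (real d)\<^sup>2 * exp (- real n * s\<^sup>2 / 2)"
      unfolding bad_def \<mu>_def
      by (rule contrast_concentration[OF n0 _ _ less neq]) (use t k in \<open>auto simp: s_def\<close>)
    also have "\<dots> \<le> 2 * (real d)\<^sup>2 * exp (- (\<nu> / 2 * real d powr (\<epsilon> / 2)))"
    proof -
      have "s\<^sup>2 = real d powr (- (\<epsilon> / 2))"
        by (simp add: s_def power2_eq_square flip: powr_add)
      moreover have "real d powr \<epsilon> * real d powr (- (\<epsilon> / 2)) = real d powr (\<epsilon> / 2)"
        by (simp flip: powr_add)
      ultimately have "\<nu> * real d powr (\<epsilon> / 2) \<le> real n * s\<^sup>2"
        using mult_right_mono[OF n, of "s\<^sup>2"] by (simp add: mult.assoc)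
      then show ?thesis by (intro mult_left_mono) auto
    qed
    also have "\<dots> \<le> exp (- (\<nu> / 4) * real d powr (\<epsilon> / 2))"
      using N[of d] d by simp
    finally have bad: "measure_pmf.prob (samples_pmf d n) bad \<le> exp (- (\<nu> / 4) * real d powr (\<epsilon> / 2))" .
    \<comment> \<open>The oracle property is available only on the support, so the inclusion is
      restricted to it; this costs no probability.\<close>
    have sub: "- bad \<inter> set_pmf (samples_pmf d n) \<subseteq> good"
    proof
      fix x assume x: "x \<in> - bad \<inter> set_pmf (samples_pmf d n)"
      define W where "W = 0\<^sub>m d t - \<eta> \<cdot>\<^sub>m G x (0\<^sub>m d t)"
      have oracle_x: "approx_gradient_oracle \<delta> d t (loss d n t e x) (G x)" using x G by blast
      then have "G x (0\<^sub>m d t) \<in> carrier_mat d t" unfolding approx_gradient_oracle_def by simp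
      then have W: "W \<in> carrier_mat d t" unfolding W_def by (intro minus_carrier_mat smult_carrier_mat)
      have entries: "\<bar>W $$ (q, m) - W $$ (e (2 * m), m) - \<eta> / real d * \<mu> m q\<bar> \<le> \<tau>"
        if "m < t" "q < d" for m q
      proof -
        have "\<bar>(\<Sum>l<n. contrast d (e (2 * m)) (e (2 * m + 1)) q (x l)) / real n - \<mu> m q\<bar> \<le> s"
          using x that unfolding bad_def by force
        then have "\<bar>W $$ (q, m) - W $$ (e (2 * m), m) - \<eta> / real d * \<mu> m q\<bar>
            \<le> \<eta> / real d * s + 2 * \<eta> * \<delta>"
          unfolding W_def
          using gradient_step_entries[of d n m t e q \<delta> x "G x" \<eta> "\<mu> m q" s] d0 n0 that less[of "2 * m"]
            oracle_x \<eta>0 by simp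
        then show ?thesis using noise by linarith
      qed
      have push: "\<gamma>\<^sub>1 * real d powr (\<epsilon> / 8) \<le> \<eta> / real d"
      proof -
        have "real d powr (1 + \<epsilon> / 8) = real d * real d powr (\<epsilon> / 8)"
          using d0 by (subst powr_add) simp
        then show ?thesis using \<eta>(1) d0 by (simp only: le_divide_eq of_nat_0_less_iff if_True mult_ac)
      qed
      have "linf_norm (2 \<cdot>\<^sub>v (softmax W *\<^sub>v all_ones (k div 2)) - indicator_vec d b)
          \<le> 2 * \<tau> + 3 * (real d * exp (- B))"
      proof (rule linf_norm_softmax_indicator_le)
        fix m assume m: "m < k div 2"
        then have mt: "m < t" "e (2 * m + 1) < d" using t by (auto intro!: less)
        \<comment> \<open>Taking \<open>q\<close> to be the partner row, the expected contrast is 0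
          and only noise separates the two rows of the pair.\<close>
        show "\<bar>W $$ (e (2 * m + 1), m) - W $$ (e (2 * m), m)\<bar> \<le> \<tau>"
          using entries[OF mt] by (simp add: \<mu>_def)
        fix q assume q: "q < d" "q \<notin> {e (2 * m), e (2 * m + 1)}"
        have "W $$ (q, m) - W $$ (e (2 * m), m) \<le> \<tau> - \<eta> / real d / 8"
          using entries[OF mt(1) q(1)] q(2) by (simp add: \<mu>_def)
        then show "W $$ (q, m) - W $$ (e (2 * m), m) \<le> - B"
          using divide_right_mono[OF push, of 8] \<tau>(2) unfolding B_def by argo
      qed (use W t d0 k b \<tau> in auto)
      also have "\<dots> \<le> (2 * \<Gamma> + 3) * real d powr (- (\<epsilon> / 8))"
        using B by (simp add: \<tau>_def algebra_simps)
      finally show "x \<in> good" unfolding good_def Let_def W_def t by simp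
    qed
    have "1 - measure_pmf.prob (samples_pmf d n) bad = measure_pmf.prob (samples_pmf d n) (- bad)"
      using measure_pmf.prob_compl[of bad "samples_pmf d n"] by (simp add: Compl_eq_Diff_UNIV)
    also have "\<dots> = measure_pmf.prob (samples_pmf d n) (- bad \<inter> set_pmf (samples_pmf d n))"
      by (simp add: measure_Int_set_pmf)
    also have "\<dots> \<le> measure_pmf.prob (samples_pmf d n) good"
      by (intro measure_pmf.finite_measure_mono sub) simp
    finally show ?thesis using bad unfolding good_def by linarith
  qed
  show ?thesis
  proof (intro exI conjI allI impI)
    show "\<nu> / 4 > 0" "2 * \<Gamma> + 3 > 0" "max 1 N > 0" using assms \<Gamma> by auto
  qed (rule main; assumption)
qed

end
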